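(* Let $p/q$ be a rational number in lowest terms with $q\ge 1$, let $m\ge 0$ be an integer, and let $(u_n)_{n\ge1}$ be an arbitrary sequence of positive integers. Write $p/q=[a_0;a_1,\dots,a_{2k}]$ as a finite continued fraction whose last partial quotient has even index $2k$, $k\ge 0$, and let $q_{2k-1}$ be the denominator of its $(2k-1)$th convergent. Set $$y_0=mq+q_{2k-1}+1,\qquad x_1=q,$$ and define $(y_n)_{n\ge 0}$, $(x_n)_{n\ge 1}$ by $$y_j=y_{j-1}(1+u_jx_j),\qquad x_{j+1}=x_jy_j,\qquad j\ge 1.$$ Let $$\alpha=\frac pq+\sum_{j=2}^\infty\frac1{x_j}.$$ Then the continued fraction expansion of $\alpha$ is the infinite continued fraction $\alpha=[a_0;a_1,a_2,\dots]$, where $a_0,\dots,a_{2k}$ are the partial quotients of the expansion $p/q=[a_0;a_1,\dots,a_{2k}]$, and $$a_{2k+1}=m+u_1y_0,\qquad a_{2k+2j}=x_j,\qquad a_{2k+2j+1}=u_{j+1}y_j\qquad\text{for all } j\ge 1.$$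
   Context: Continued fractions: $[a_0;a_1,\dots,a_n]=a_0+\cfrac{1}{a_1+\cfrac{1}{\cdots+\cfrac1{a_n}}}$ with $a_0\in\mathbb Z$ and $a_j\in\mathbb Z_{>0}$ for $j\ge1$, and $[a_0;a_1,a_2,\dots]=\lim_{n\to\infty}[a_0;a_1,\dots,a_n]$. Convergents $p_n/q_n=[a_0;\dots,a_n]$ are given by $p_{n+1}=a_{n+1}p_n+p_{n-1}$, $q_{n+1}=a_{n+1}q_n+q_{n-1}$ for $n\ge -1$, with $p_{-1}=1$, $p_{-2}=0$, $q_{-1}=0$, $q_{-2}=1$. Every rational number has a finite continued fraction whose last index is even, because $[a_0;\dots,a_j]=[a_0;\dots,a_j-1,1]$ if $j=0$ or $a_j>1$, and $[a_0;\dots,a_{j-1},1]=[a_0;\dots,a_{j-1}+1]$. *)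

theory Defs
  imports Complex_Main
begin

text \<open>\<open>cf_value a n\<close> is the finite continued fraction
  \<open>[a 0; a 1, \<dots>, a n]\<close>; only \<open>a 0, \<dots>, a n\<close> are used.\<close>

fun cf_value :: "(nat \<Rightarrow> int) \<Rightarrow> nat \<Rightarrow> real" where
  "cf_value a 0 = of_int (a 0)"
| "cf_value a (Suc n) = of_int (a 0) + 1 / cf_value (\<lambda>i. a (Suc i)) n"

text \<open>Denominators \<open>q\<^sub>n\<close> of the convergents, with the index shifted by two so that the
  initial values \<open>q\<^sub>-\<^sub>2 = 1\<close> and \<open>q\<^sub>-\<^sub>1 = 0\<close> are included:
  \<open>cf_den a n\<close> is \<open>q\<close> with index \<open>n - 2\<close>.\<close>

fun cf_den :: "(nat \<Rightarrow> int) \<Rightarrow> nat \<Rightarrow> int" where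
  "cf_den a 0 = 1"
| "cf_den a (Suc 0) = 0"
| "cf_den a (Suc (Suc n)) = a n * cf_den a (Suc n) + cf_den a n"

definition finite_cf_expansion :: "(nat \<Rightarrow> int) \<Rightarrow> nat \<Rightarrow> real \<Rightarrow> bool" where
  "finite_cf_expansion a n r \<longleftrightarrow> (\<forall>j. 1 \<le> j \<and> j \<le> n \<longrightarrow> a j > 0) \<and> r = cf_value a n"

definition infinite_cf_expansion :: "(nat \<Rightarrow> int) \<Rightarrow> real \<Rightarrow> bool" where
  "infinite_cf_expansion a r \<longleftrightarrow> (\<forall>j\<ge>1. a j > 0) \<and> cf_value a \<longlonglongrightarrow> r"

end

theory Submission
  imports Defs
begin

text \<open>By the recursion for the denominators, the continued fraction \<open>c\<close> of the theorem satisfies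
  \<open>q\<^bsub>2k+2j\<^esub> = x\<^bsub>j+1\<^esub>\<close> and \<open>q\<^bsub>2k+2j+1\<^esub> = y\<^bsub>j+1\<^esub> - 1\<close>. Two convergents of consecutive even
  indices \<open>n\<close> and \<open>n + 2\<close> differ by \<open>c\<^bsub>n+2\<^esub> / (q\<^bsub>n\<^esub> q\<^bsub>n+2\<^esub>)\<close>. For \<open>n = 2k + 2j\<close> the partial quotient
  \<open>c\<^bsub>n+2\<^esub> = x\<^bsub>j+1\<^esub>\<close> cancels \<open>q\<^bsub>n\<^esub>\<close>, so the difference is \<open>1 / x\<^bsub>j+2\<^esub>\<close>, and the convergents of even
  index from \<open>2k\<close> on are exactly \<open>p/q\<close> plus the partial sums of the series. Those of odd index have the same limit
  because consecutive convergents differ by \<open>\<plusminus>1 / (q\<^bsub>n\<^esub> q\<^bsub>n+1\<^esub>)\<close>.\<close>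

text \<open>As in \<open>cf_den\<close>, the index of \<open>cf_num\<close> is shifted by two.\<close>

fun cf_num :: "(nat \<Rightarrow> int) \<Rightarrow> nat \<Rightarrow> int" where
  "cf_num a 0 = 0"
| "cf_num a (Suc 0) = 1"
| "cf_num a (Suc (Suc n)) = a n * cf_num a (Suc n) + cf_num a n"

section \<open>Convergents as quotients of numerators and denominators\<close>

lemma cf_value_cong: "(\<And>i. i \<le> n \<Longrightarrow> a i = b i) \<Longrightarrow> cf_value a n = cf_value b n"
proof (induction n arbitrary: a b)
  case (Suc n)
  have "cf_value (\<lambda>i. a (Suc i)) n = cf_value (\<lambda>i. b (Suc i)) n"
    by (rule Suc.IH) (simp add: Suc.prems)
  with Suc.prems[of 0] show ?case by simp
qed simp

lemma cf_den_cong: "(\<And>i. i + 2 \<le> n \<Longrightarrow> a i = b i) \<Longrightarrow> cf_den a n = cf_den b n"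
  by (induction a n rule: cf_den.induct) auto

text \<open>This links two ways of unfolding: \<open>cf_value\<close> splits off the first partial
  quotient, while \<open>cf_num\<close> and \<open>cf_den\<close> append the last one. In
  \<open>n\<close>, both sides of each equation satisfy the same two-term recursion with the same
  initial values.\<close>

lemma cf_num_den_Suc:
  "cf_num a (Suc n) = a 0 * cf_num (\<lambda>i. a (Suc i)) n + cf_den (\<lambda>i. a (Suc i)) n \<and>
   cf_den a (Suc n) = cf_num (\<lambda>i. a (Suc i)) n"
  by (induction "\<lambda>i. a (Suc i)" n rule: cf_num.induct) (auto simp: algebra_simps)

text \<open>The first bound is not strict because it includes q_{-1} = 0 at \<open>n = 0\<close>.
  The same zero cancels \<open>a 0\<close>, which may therefore have any sign.\<close>

lemma cf_den_nonneg_pos: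
  assumes "\<And>j. 1 \<le> j \<Longrightarrow> j \<le> n \<Longrightarrow> a j > 0"
  shows "cf_den a (Suc n) \<ge> 0 \<and> cf_den a (Suc (Suc n)) > 0"
  using assms
proof (induction n)
  case (Suc n)
  then have "cf_den a (Suc n) \<ge> 0" "cf_den a (Suc (Suc n)) > 0" "a (Suc n) > 0"
    by auto
  then show ?case by (simp add: add_pos_nonneg)
qed simp

lemma cf_value_eq_quotient:
  assumes "\<And>j. 1 \<le> j \<Longrightarrow> j \<le> n \<Longrightarrow> a j > 0"
  shows "cf_value a n = of_int (cf_num a (n + 2)) / of_int (cf_den a (n + 2))"
  using assms
proof (induction n arbitrary: a)
  case (Suc n)
  let ?b = "\<lambda>i. a (Suc i)"
  have IH: "cf_value ?b n = of_int (cf_num ?b (n + 2)) / of_int (cf_den ?b (n + 2))"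
    using Suc.prems by (intro Suc.IH) simp
  \<comment> \<open>The numerator of the tail is the denominator of the whole fraction, so the tail
    is nonzero and a_0 + 1/(P/Q) = (a_0 P + Q)/P applies.\<close>
  have "cf_den a (Suc (n + 2)) > 0"
    using cf_den_nonneg_pos[of "Suc n" a] Suc.prems by simp
  then have "cf_num ?b (n + 2) > 0"
    using cf_num_den_Suc[of a "n + 2"] by simp
  then show ?case
    using cf_num_den_Suc[of a "n + 2"]
    by (simp del: cf_num.simps cf_den.simps add_2_eq_Suc' add: IH field_simps)
qed simp

section \<open>Determinants and differences of convergents\<close>

lemma cf_determinant:
  "cf_num a (Suc n) * cf_den a n - cf_num a n * cf_den a (Suc n) = (-1) ^ n"
proof (induction n)
  case (Suc n)
  have "cf_num a (Suc (Suc n)) * cf_den a (Suc n) - cf_num a (Suc n) * cf_den a (Suc (Suc n))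
      = - (cf_num a (Suc n) * cf_den a n - cf_num a n * cf_den a (Suc n))"
    by (simp add: algebra_simps)
  with Suc show ?case by simp
qed simp

text \<open>Expanding the two terms of index \<open>Suc (Suc n)\<close> by the recursion leaves
  \<open>a n\<close> times the determinant of consecutive convergents.\<close>

lemma cf_determinant_two_steps:
  "cf_num a (Suc (Suc n)) * cf_den a n - cf_num a n * cf_den a (Suc (Suc n)) = a n * (-1) ^ n"
  unfolding cf_determinant[of a n, symmetric] by (simp add: algebra_simps)

lemma coprime_cf_num_den: "coprime (cf_num a n) (cf_den a n)"
proof (rule coprimeI)
  fix d assume "d dvd cf_num a n" "d dvd cf_den a n"
  then have "d dvd cf_num a (Suc n) * cf_den a n - cf_num a n * cf_den a (Suc n)"
    by simp
  then have "d dvd (-1) ^ n"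
    by (simp only: cf_determinant)
  then show "is_unit d"
    by (rule dvd_trans) simp
qed

lemma cf_value_Suc_diff:
  assumes "\<And>j. 1 \<le> j \<Longrightarrow> j \<le> Suc n \<Longrightarrow> a j > 0"
  shows "cf_value a (Suc n) - cf_value a n
    = (-1) ^ n / (of_int (cf_den a (n + 2)) * of_int (cf_den a (n + 3)))"
proof -
  have "cf_den a (n + 2) > 0" "cf_den a (n + 3) > 0"
    using cf_den_nonneg_pos[of n a] cf_den_nonneg_pos[of "Suc n" a] assms
    by (simp_all del: cf_den.simps add: numeral_3_eq_3)
  moreover have "real_of_int (cf_num a (n + 3)) * of_int (cf_den a (n + 2))
      - of_int (cf_num a (n + 2)) * of_int (cf_den a (n + 3)) = (-1) ^ n"
    using arg_cong[OF cf_determinant[of a "n + 2"], of real_of_int]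
    by (simp del: cf_den.simps cf_num.simps add: numeral_3_eq_3)
  moreover have "cf_value a n = of_int (cf_num a (n + 2)) / of_int (cf_den a (n + 2))"
    "cf_value a (Suc n) = of_int (cf_num a (n + 3)) / of_int (cf_den a (n + 3))"
    using cf_value_eq_quotient[of n a] cf_value_eq_quotient[of "Suc n" a] assms
    by (simp_all del: cf_den.simps cf_num.simps cf_value.simps add: numeral_3_eq_3)
  ultimately show ?thesis
    by (simp del: cf_den.simps cf_num.simps cf_value.simps add: diff_frac_eq mult.commute)
qed

lemma cf_value_two_steps_diff:
  assumes "\<And>j. 1 \<le> j \<Longrightarrow> j \<le> n + 2 \<Longrightarrow> a j > 0"
  shows "cf_value a (n + 2) - cf_value a n
    = of_int (a (n + 2)) * (-1) ^ n / (of_int (cf_den a (n + 2)) * of_int (cf_den a (n + 4)))"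
proof -
  have "cf_den a (n + 2) > 0" "cf_den a (n + 4) > 0"
    using cf_den_nonneg_pos[of n a] cf_den_nonneg_pos[of "n + 2" a] assms
    by (simp_all del: cf_den.simps add: eval_nat_numeral)
  moreover have "real_of_int (cf_num a (n + 4)) * of_int (cf_den a (n + 2))
      - of_int (cf_num a (n + 2)) * of_int (cf_den a (n + 4)) = of_int (a (n + 2)) * (-1) ^ n"
    using arg_cong[OF cf_determinant_two_steps[of a "n + 2"], of real_of_int]
    by (simp del: cf_den.simps cf_num.simps add: eval_nat_numeral)
  moreover have "cf_value a n = of_int (cf_num a (n + 2)) / of_int (cf_den a (n + 2))"
    "cf_value a (n + 2) = of_int (cf_num a (n + 4)) / of_int (cf_den a (n + 4))"
    using cf_value_eq_quotient[of n a] cf_value_eq_quotient[of "n + 2" a] assms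
    by (simp_all del: cf_den.simps cf_num.simps cf_value.simps add: eval_nat_numeral)
  ultimately show ?thesis
    by (simp del: cf_den.simps cf_num.simps cf_value.simps add: diff_frac_eq mult.commute)
qed

text \<open>The last convergent and p/q are both in lowest terms with positive denominators, so
  these denominators divide each other. This identifies q_{2k} with q, the initial value
  \<open>x 1\<close>.\<close>

lemma cf_den_eq_denominator:
  assumes "q \<ge> 1" "coprime p q" "finite_cf_expansion a n (of_int p / of_int q)"
  shows "cf_den a (n + 2) = q"
proof -
  have pos: "\<And>j. 1 \<le> j \<Longrightarrow> j \<le> n \<Longrightarrow> a j > 0"
    and val: "of_int p / of_int q = cf_value a n"
    using assms(3) by (auto simp: finite_cf_expansion_def)
  have den: "cf_den a (n + 2) > 0"
    using cf_den_nonneg_pos[of n a] pos by simp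
  have "real_of_int p / of_int q = of_int (cf_num a (n + 2)) / of_int (cf_den a (n + 2))"
    using val cf_value_eq_quotient[OF pos] by simp
  then have "real_of_int (p * cf_den a (n + 2)) = of_int (cf_num a (n + 2) * q)"
    using den assms(1) by (simp del: cf_den.simps cf_num.simps add_2_eq_Suc' add: field_simps)
  then have eq: "p * cf_den a (n + 2) = cf_num a (n + 2) * q"
    by (simp only: of_int_eq_iff)
  have "q dvd cf_den a (n + 2)"
    using assms(2) eq by (metis coprime_commute coprime_dvd_mult_right_iff dvd_triv_right)
  moreover have "cf_den a (n + 2) dvd q"
    using coprime_cf_num_den[of a "n + 2"] eq
    by (metis coprime_commute coprime_dvd_mult_right_iff dvd_triv_right)
  ultimately show ?thesis
    using den assms(1) by (intro zdvd_antisym_nonneg) auto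
qed

lemma LIMSEQ_from_even_odd:
  fixes f :: "nat \<Rightarrow> 'a::topological_space"
  assumes "(\<lambda>n. f (2 * n)) \<longlonglongrightarrow> l" "(\<lambda>n. f (Suc (2 * n))) \<longlonglongrightarrow> l"
  shows "f \<longlonglongrightarrow> l"
proof (rule topological_tendstoI)
  fix S assume S: "open S" "l \<in> S"
  obtain M where M: "\<And>n. n \<ge> M \<Longrightarrow> f (2 * n) \<in> S"
    using topological_tendstoD[OF assms(1) S] by (auto simp: eventually_sequentially)
  obtain N where N: "\<And>n. n \<ge> N \<Longrightarrow> f (Suc (2 * n)) \<in> S"
    using topological_tendstoD[OF assms(2) S] by (auto simp: eventually_sequentially)
  show "\<forall>\<^sub>F n in sequentially. f n \<in> S"
  proof (rule eventually_sequentiallyI)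
    fix n assume n: "2 * (M + N) + 1 \<le> n"
    show "f n \<in> S"
    proof (cases "even n")
      case True
      then obtain j where "n = 2 * j" by (rule evenE)
      with n M[of j] show ?thesis by simp
    next
      case False
      then obtain j where "n = 2 * j + 1" by (rule oddE)
      with n N[of j] show ?thesis by simp
    qed
  qed
qed

theorem theorem2p1:
  fixes p q m :: int and k :: nat
    and a u x y :: "nat \<Rightarrow> int"
    and \<alpha> :: real
  assumes "q \<ge> 1" and "coprime p q"
    and "m \<ge> 0"
    and "\<forall>n\<ge>1. u n > 0"
    and "finite_cf_expansion a (2 * k) (of_int p / of_int q)"
    and "y 0 = m * q + cf_den a (2 * k + 1) + 1"  \<comment> \<open>\<open>cf_den a (2 * k + 1)\<close> has index \<open>2k - 1\<close>\<close>
    and "x 1 = q"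
    and "\<forall>j\<ge>1. y j = y (j - 1) * (1 + u j * x j)"
    and "\<forall>j\<ge>1. x (j + 1) = x j * y j"
    and "\<alpha> = of_int p / of_int q + (\<Sum>j. 1 / of_int (x (j + 2)))"
  shows "summable (\<lambda>j. 1 / of_int (x (j + 2)) :: real) \<and>
    (\<exists>c. infinite_cf_expansion c \<alpha> \<and>
      (\<forall>j\<le>2 * k. c j = a j) \<and>
      c (2 * k + 1) = m + u 1 * y 0 \<and>
      (\<forall>j\<ge>1. c (2 * k + 2 * j) = x j \<and> c (2 * k + 2 * j + 1) = u (j + 1) * y j))"
proof -

  \<comment> \<open>Positivity and growth of \<open>x\<close> and \<open>y\<close>\<close>
  let ?s = "\<lambda>j. 1 / of_int (x (j + 2)) :: real"
  have u: "u n > 0" if "n \<ge> 1" for n using assms(4) that by simp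
  have y_rec: "y (Suc j) = y j * (1 + u (Suc j) * x (Suc j))" for j
    using assms(8) by simp
  have x_rec: "x (Suc (Suc j)) = x (Suc j) * y (Suc j)" for j
    using assms(9) by simp
  have a_pos: "a j > 0" if "1 \<le> j" "j \<le> 2 * k" for j
    using assms(5) that by (simp add: finite_cf_expansion_def)
  have "cf_den a (2 * k + 1) \<ge> 0"
    using cf_den_nonneg_pos[of "2 * k" a] a_pos by simp
  then have y0: "y 0 \<ge> 1" using assms(1,3,6) by simp
  \<comment> \<open>Only \<open>y 0\<close> can equal 1; every later \<open>y\<close> is at least 2,
    so each step at least doubles \<open>x\<close>. The bound 2 also keeps the denominators
    \<open>y (Suc j) - 1\<close> of odd index positive.\<close>
  have xy: "x (Suc j) \<ge> 2 ^ j \<and> y j \<ge> 1 \<and> y (Suc j) \<ge> 2" for j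
  proof (induction j)
    case 0
    have "u 1 * x 1 \<ge> 1 * 1" using u[of 1] assms(1,7) by (intro mult_mono) auto
    then have "y 0 * (1 + u 1 * x 1) \<ge> 1 * 2" using y0 by (intro mult_mono) auto
    then show ?case using y0 assms(1,7) y_rec[of 0] by simp
  next
    case (Suc j)
    have "(0::int) \<le> 2 ^ j" by simp
    with Suc have "x (Suc j) \<ge> 0" by linarith
    with Suc have "x (Suc j) * y (Suc j) \<ge> 2 ^ j * 2" by (intro mult_mono) auto
    then have x: "x (Suc (Suc j)) \<ge> 2 ^ Suc j" by (simp add: x_rec)
    moreover have "(2::int) ^ Suc j \<ge> 1" by (rule one_le_power) simp
    ultimately have "x (Suc (Suc j)) > 0" by linarith
    then have "u (Suc (Suc j)) * x (Suc (Suc j)) > 0" using u[of "Suc (Suc j)"] by simp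
    then have "y (Suc j) * (1 + u (Suc (Suc j)) * x (Suc (Suc j))) \<ge> 2 * 1"
      using Suc by (intro mult_mono) auto
    then show ?case using x Suc y_rec[of "Suc j"] by simp
  qed
  have x_pos: "x (Suc j) > 0" for j
    using xy[of j] by (smt (verit) zero_less_power)
  have y_pos: "y j > 0" for j using xy[of j] by simp

  \<comment> \<open>The partial quotients of the expansion\<close>
  define c where "c i = (if i \<le> 2 * k then a i
      else if i = 2 * k + 1 then m + u 1 * y 0
      else if even i then x ((i - 2 * k) div 2)
      else u ((i - 2 * k) div 2 + 1) * y ((i - 2 * k) div 2))" for i
  have c_le: "c j = a j" if "j \<le> 2 * k" for j using that by (simp add: c_def)
  \<comment> \<open>The general odd formula would give only \<open>u 1 * y 0\<close> at this index;
    the summand \<open>m\<close> makes it a separate case.\<close>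
  have c_first: "c (2 * k + 1) = m + u 1 * y 0" by (simp add: c_def)
  have c_even: "c (2 * k + 2 * j) = x j" if "j \<ge> 1" for j
    using that by (simp add: c_def)
  have c_odd: "c (2 * k + 2 * j + 1) = u (j + 1) * y j" if "j \<ge> 1" for j
    using that by (simp add: c_def)
  have c_pos: "c j > 0" if "j \<ge> 1" for j
  proof (cases "j \<le> 2 * k")
    case True
    then show ?thesis using a_pos that by (simp add: c_le)
  next
    case False
    define i where "i = (j - 2 * k) div 2"
    have "j = 2 * k + 2 * i \<and> i \<ge> 1 \<or> j = 2 * k + 1 \<or> j = 2 * k + 2 * i + 1 \<and> i \<ge> 1"
      unfolding i_def using False by presburger
    moreover have "u 1 * y 0 > 0" "u (i + 1) * y i > 0" using u y_pos by simp_all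
    moreover have "x i > 0" if "i \<ge> 1" using x_pos[of "i - 1"] that by simp
    ultimately show ?thesis
      using c_first c_even[of i] c_odd[of i] assms(3) by auto
  qed

  \<comment> \<open>Denominators of the convergents of \<open>c\<close>\<close>
  have den_first: "cf_den c (2 * k + 1) = cf_den a (2 * k + 1)"
    by (rule cf_den_cong) (simp add: c_le)
  have "cf_den c (2 * k + 2) = cf_den a (2 * k + 2)"
    by (rule cf_den_cong) (simp add: c_le)
  with assms(7) cf_den_eq_denominator[OF assms(1,2,5)]
  have den_second: "cf_den c (2 * k + 2) = x 1" by simp
  have den: "cf_den c (2 * k + 2 * j + 2) = x (Suc j) \<and>
      cf_den c (2 * k + 2 * j + 3) = y (Suc j) - 1" for j
  proof (induction j)
    case 0
    have "cf_den c (2 * k + 3) = c (2 * k + 1) * cf_den c (2 * k + 2) + cf_den c (2 * k + 1)"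
      by (simp add: numeral_3_eq_3)
    \<comment> \<open>The definition of \<open>y 0\<close> is solved for q_{2k-1}. Since
      \<open>x 1 = q\<close>, the terms with \<open>m\<close> then cancel and
      \<open>y 0 * (1 + u 1 * x 1) - 1\<close> remains.\<close>
    also have "\<dots> = (m + u 1 * y 0) * x 1 + (y 0 - m * q - 1)"
      by (simp only: c_first den_first den_second assms(6))
    also have "\<dots> = y 1 - 1"
      using y_rec[of 0] assms(7) by (simp add: algebra_simps)
    finally show ?case using den_second by simp
  next
    case (Suc j)
    have "cf_den c (2 * k + 2 * Suc j + 2)
        = c (2 * k + 2 * Suc j) * cf_den c (2 * k + 2 * j + 3) + cf_den c (2 * k + 2 * j + 2)"
      by (simp add: numeral_3_eq_3)
    also have "\<dots> = x (Suc j) * (y (Suc j) - 1) + x (Suc j)"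
      using Suc c_even[of "Suc j"] by (simp only:)
    finally have even: "cf_den c (2 * k + 2 * Suc j + 2) = x (Suc (Suc j))"
      by (simp add: x_rec algebra_simps)
    have "cf_den c (2 * k + 2 * Suc j + 3)
        = c (2 * k + 2 * Suc j + 1) * cf_den c (2 * k + 2 * Suc j + 2)
          + cf_den c (2 * k + 2 * j + 3)"
      by (simp add: numeral_3_eq_3)
    also have "\<dots> = u (Suc (Suc j)) * y (Suc j) * x (Suc (Suc j)) + (y (Suc j) - 1)"
      using Suc even c_odd[of "Suc j"] by (simp only:) simp
    finally have "cf_den c (2 * k + 2 * Suc j + 3) = y (Suc (Suc j)) - 1"
      by (simp add: y_rec[of "Suc j"] algebra_simps)
    with even show ?case by simp
  qed

  \<comment> \<open>Convergents of even index as partial sums\<close>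
  have value_even: "cf_value c (2 * k + 2 * n) = of_int p / of_int q + (\<Sum>j<n. ?s j)" for n
  proof (induction n)
    case 0
    have "cf_value c (2 * k) = cf_value a (2 * k)"
      by (rule cf_value_cong) (simp add: c_le)
    then show ?case using assms(5) by (simp add: finite_cf_expansion_def)
  next
    case (Suc n)
    have index: "2 * k + 2 * n + 2 = 2 * k + 2 * Suc n"
      "2 * k + 2 * n + 4 = 2 * k + 2 * Suc n + 2" by simp_all
    have "cf_value c (2 * k + 2 * Suc n) - cf_value c (2 * k + 2 * n)
        = of_int (c (2 * k + 2 * Suc n)) * (-1) ^ (2 * k + 2 * n)
          / (of_int (cf_den c (2 * k + 2 * n + 2)) * of_int (cf_den c (2 * k + 2 * Suc n + 2)))"
      using cf_value_two_steps_diff[of "2 * k + 2 * n" c] c_pos by (simp only: index)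
    also have "\<dots> = of_int (x (Suc n)) / (of_int (x (Suc n)) * of_int (x (Suc (Suc n))))"
      using den[of n] den[of "Suc n"] c_even[of "Suc n"] by (simp only:) simp
    also have "\<dots> = ?s n"
      using x_pos[of n] by simp
    finally show ?case using Suc by (simp del: cf_value.simps)
  qed

  \<comment> \<open>Convergence to \<alpha>\<close>
  have s_le: "norm (?s j) \<le> (1 / 2) ^ j" for j
  proof -
    have "(0::int) \<le> 2 ^ j" by simp
    with xy[of "Suc j"] have "2 ^ j \<le> x (j + 2)"
      unfolding add_2_eq_Suc' power_Suc by linarith
    then have ge: "real_of_int (2 ^ j) \<le> of_int (x (j + 2))" by (simp only: of_int_le_iff)
    have "1 / real_of_int (x (j + 2)) \<le> 1 / real_of_int (2 ^ j)"
      by (rule frac_le[OF _ _ _ ge]) simp_all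
    moreover have "norm (?s j) = 1 / real_of_int (x (j + 2))"
      using x_pos[of "Suc j"] by simp
    ultimately show ?thesis by (simp only: power_one_over of_int_power of_int_numeral)
  qed
  have summable: "summable ?s"
    by (rule summable_comparison_test[OF _ summable_geometric[of "1 / 2 :: real"]])
      (use s_le in auto)
  \<comment> \<open>The shift by \<open>2 * k\<close> skips the part before p/q and preserves
    parity, as needed for \<open>LIMSEQ_from_even_odd\<close>; \<open>LIMSEQ_offset\<close> removes
    it at the end.\<close>
  have even_lim: "(\<lambda>n. cf_value c (2 * n + 2 * k)) \<longlonglongrightarrow> \<alpha>"
  proof -
    have "(\<lambda>n. of_int p / of_int q + (\<Sum>j<n. ?s j)) \<longlonglongrightarrow> \<alpha>"
      unfolding assms(10) by (intro tendsto_intros summable_LIMSEQ summable)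
    then show ?thesis by (simp only: value_even[symmetric] add.commute)
  qed
  have odd_lim: "(\<lambda>n. cf_value c (Suc (2 * n + 2 * k))) \<longlonglongrightarrow> \<alpha>"
  proof -
    let ?d = "\<lambda>n. cf_value c (Suc (2 * n + 2 * k)) - cf_value c (2 * n + 2 * k)"
    have d: "norm (?d n) \<le> (1 / 2) ^ n" for n
    proof -
      have "?d n = (-1) ^ (2 * k + 2 * n)
          / (of_int (cf_den c (2 * k + 2 * n + 2)) * of_int (cf_den c (2 * k + 2 * n + 3)))"
        using cf_value_Suc_diff[of "2 * k + 2 * n" c] c_pos
        by (simp only: add.commute[of "2 * n" "2 * k"])
      also have "\<dots> = 1 / of_int (x (Suc n) * (y (Suc n) - 1))"
        using den[of n] by (simp only:) simp
      finally have eq: "?d n = 1 / of_int (x (Suc n) * (y (Suc n) - 1))" .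
      \<comment> \<open>The factor 1 is where \<open>y (Suc n) \<ge> 2\<close> enters.\<close>
      have "2 ^ n * 1 \<le> x (Suc n) * (y (Suc n) - 1)"
        using xy[of n] x_pos[of n] by (intro mult_mono) auto
      then have ge: "2 ^ n \<le> real_of_int (x (Suc n) * (y (Suc n) - 1))"
        by (metis mult_1_right of_int_le_iff of_int_numeral of_int_power)
      have "0 < (2::real) ^ n" by simp
      with ge show ?thesis
        unfolding eq by (simp only: power_one_over real_norm_def abs_divide) (simp add: frac_le)
    qed
    have "?d \<longlonglongrightarrow> 0"
      by (rule tendsto_0_le[where K = 1, OF LIMSEQ_power_zero[of "1 / 2 :: real"]])
        (use d in \<open>simp_all del: cf_value.simps real_norm_def add: norm_power\<close>)
    from tendsto_add[OF this even_lim] show ?thesis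
      by (simp del: cf_value.simps)
  qed
  have "(\<lambda>n. cf_value c (n + 2 * k)) \<longlonglongrightarrow> \<alpha>"
    by (rule LIMSEQ_from_even_odd) (use even_lim odd_lim in \<open>simp_all del: cf_value.simps\<close>)
  then have "cf_value c \<longlonglongrightarrow> \<alpha>" by (rule LIMSEQ_offset)
  then have "infinite_cf_expansion c \<alpha>"
    using c_pos by (simp add: infinite_cf_expansion_def)
  with summable c_le c_first c_even c_odd show ?thesis by blast
qed

end
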